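(* Let $f:[0,1]\to[0,1]$. Let $(x_n)_{n\in\mathbb{N}}$ and $(y_n)_{n\in\mathbb{N}}$ be sequences in $[0,1]$ such that for each $n$, $y_n$ is between $x_n$ and $f(x_n)$ and $x_{n+1}$ is between $x_n$ and $f(y_n)$. Let $\omega:(0,\infty)\to(0,\infty)$ be a modulus of uniform continuity for $f$, let $\beta:(0,\infty)\to\mathbb{N}$ be such that $(x_n-x_{n+1})$ tends towards $0$ with rate of convergence $\beta$, and let $\gamma:(0,\infty)\to\mathbb{N}$ be such that $(x_n-y_n)$ tends towards $0$ with rate of convergence $\gamma$. Let $\varepsilon>0$ and $g:\mathbb{N}\to\mathbb{N}$. Define \begin{align*} m&:=\left\lceil\frac{6}{\varepsilon}\right\rceil,\qquad c:=\frac{1}{4m},\\ B(p)&:=\frac{1}{\max(1,8\,m\,g(p))}\quad(p\in\mathbb{N}),\\ Z(p)&:=\min\bigl(B(p),\omega(B(p))\bigr)\quad(p\in\mathbb{N}),\\ C(p)&:=\min\left(\frac{Z(p)}{3},\omega\left(\frac{Z(p)}{3}\right)\right)\quad(p\in\mathbb{N}),\\ u_0&:=\beta(c),\\ u_{n+1}&:=\max\left(u_n+g(u_n)+1,\ \beta\left(\frac{C(u_n)}{2}\right),\ \gamma\left(\frac{C(u_n)}{2}\right)\right)\quad(n\in\mathbb{N}),\\ \Phi^{\mathrm{I}}_{\omega,\beta,\gamma}(\varepsilon,g)&:=u_{2m^2}. \end{align*} Then there is an $N\in\mathbb{N}$ with $N\leq\Phi^{\mathrm{I}}_{\omega,\beta,\gamma}(\varepsilon,g)$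 such that for all $i,j\in[N,N+g(N)]$, $|x_i-x_j|\leq\varepsilon$.
   Context: $\mathbb{N}$ contains $0$. For a real number $r$, $\lceil r\rceil$ is the least integer $\geq r$. "$z$ is between $a$ and $b$" means $\min(a,b)\leq z\leq\max(a,b)$. For $N,M\in\mathbb{N}$, indices $i,j\in[N,M]$ are natural numbers with $N\leq i,j\leq M$. A modulus of uniform continuity for $f:[0,1]\to[0,1]$ is a function $\omega:(0,\infty)\to(0,\infty)$ such that for any $\delta>0$ and any $x,y\in[0,1]$ with $|x-y|<\omega(\delta)$, we have $|f(x)-f(y)|<\delta$. A real sequence $(a_n)$ tends towards $l\in\mathbb{R}$ with rate of convergence $\beta:(0,\infty)\to\mathbb{N}$ if for all $\delta>0$ and all $n\geq\beta(\delta)$, we have $|a_n-l|\leq\delta$. *)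

theory Defs
  imports Complex_Main "HOL-Library.FuncSet"
begin

text \<open>
  Functions with domain \<open>(0,\<infinity>)\<close> or \<open>[0,1]\<close> are total functions on the reals whose values are
  constrained only on that domain; their values elsewhere are arbitrary.
\<close>

definition is_between :: "real \<Rightarrow> real \<Rightarrow> real \<Rightarrow> bool" where
  "is_between z a b \<longleftrightarrow> min a b \<le> z \<and> z \<le> max a b"

definition modulus_of_uniform_continuity :: "(real \<Rightarrow> real) \<Rightarrow> (real \<Rightarrow> real) \<Rightarrow> bool" where
  "modulus_of_uniform_continuity \<omega> f \<longleftrightarrow>
     \<omega> \<in> {0<..} \<rightarrow> {0<..} \<and>
     (\<forall>\<delta>>0. \<forall>x\<in>{0..1}. \<forall>y\<in>{0..1}. \<bar>x - y\<bar> < \<omega> \<delta> \<longrightarrow> \<bar>f x - f y\<bar> < \<delta>)"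

definition tends_with_rate :: "(nat \<Rightarrow> real) \<Rightarrow> real \<Rightarrow> (real \<Rightarrow> nat) \<Rightarrow> bool" where
  "tends_with_rate a l \<beta> \<longleftrightarrow> (\<forall>\<delta>>0. \<forall>n\<ge>\<beta> \<delta>. \<bar>a n - l\<bar> \<le> \<delta>)"

text \<open>The subscript \<open>I\<close> refers to the superscript in the name of the bound \<open>\<Phi>\<^sup>I\<close>.\<close>

definition m\<^sub>I :: "real \<Rightarrow> nat" where
  "m\<^sub>I \<epsilon> = nat \<lceil>6 / \<epsilon>\<rceil>"

definition c\<^sub>I :: "real \<Rightarrow> real" where
  "c\<^sub>I \<epsilon> = 1 / (4 * real (m\<^sub>I \<epsilon>))"

definition B\<^sub>I :: "real \<Rightarrow> (nat \<Rightarrow> nat) \<Rightarrow> nat \<Rightarrow> real" where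
  "B\<^sub>I \<epsilon> g p = 1 / max 1 (8 * real (m\<^sub>I \<epsilon>) * real (g p))"

definition Z\<^sub>I :: "(real \<Rightarrow> real) \<Rightarrow> real \<Rightarrow> (nat \<Rightarrow> nat) \<Rightarrow> nat \<Rightarrow> real" where
  "Z\<^sub>I \<omega> \<epsilon> g p = min (B\<^sub>I \<epsilon> g p) (\<omega> (B\<^sub>I \<epsilon> g p))"

definition C\<^sub>I :: "(real \<Rightarrow> real) \<Rightarrow> real \<Rightarrow> (nat \<Rightarrow> nat) \<Rightarrow> nat \<Rightarrow> real" where
  "C\<^sub>I \<omega> \<epsilon> g p = min (Z\<^sub>I \<omega> \<epsilon> g p / 3) (\<omega> (Z\<^sub>I \<omega> \<epsilon> g p / 3))"

primrec u\<^sub>I ::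
  "(real \<Rightarrow> real) \<Rightarrow> (real \<Rightarrow> nat) \<Rightarrow> (real \<Rightarrow> nat) \<Rightarrow> real \<Rightarrow> (nat \<Rightarrow> nat) \<Rightarrow> nat \<Rightarrow> nat" where
  "u\<^sub>I \<omega> \<beta> \<gamma> \<epsilon> g 0 = \<beta> (c\<^sub>I \<epsilon>)"
| "u\<^sub>I \<omega> \<beta> \<gamma> \<epsilon> g (Suc n) =
     (let p = u\<^sub>I \<omega> \<beta> \<gamma> \<epsilon> g n
      in Max {p + g p + 1, \<beta> (C\<^sub>I \<omega> \<epsilon> g p / 2), \<gamma> (C\<^sub>I \<omega> \<epsilon> g p / 2)})"

definition \<Phi>\<^sub>I ::
  "(real \<Rightarrow> real) \<Rightarrow> (real \<Rightarrow> nat) \<Rightarrow> (real \<Rightarrow> nat) \<Rightarrow> real \<Rightarrow> (nat \<Rightarrow> nat) \<Rightarrow> nat" where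
  "\<Phi>\<^sub>I \<omega> \<beta> \<gamma> \<epsilon> g = u\<^sub>I \<omega> \<beta> \<gamma> \<epsilon> g (2 * (m\<^sub>I \<epsilon>)\<^sup>2)"

end

theory Submission
  imports Defs
begin

text \<open>
  Suppose, for contradiction, that on each of the windows \<open>[u\<^sub>n, u\<^sub>n + g(u\<^sub>n)]\<close>, \<open>n \<le> 2m\<^sup>2\<close>, the sequence \<open>x\<close> oscillates by
  more than \<open>\<epsilon> \<ge> 6/m\<close>.  Cut \<open>[0,1]\<close> into the \<open>m\<close> cells \<open>[k/m, (k+1)/m]\<close>.  In every window \<open>x\<close> passes
  from one end of some cell to the other.  Since single steps are at most \<open>1/(4m)\<close> and the
  window has only \<open>g(u\<^sub>n)\<close> steps, some step that starts at a point \<open>z\<close> strictly inside the cell has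
  length at least \<open>2 B(u\<^sub>n)\<close> (\<open>ex_large_step_in_crossing\<close>); uniform continuity then forces
  \<open>\<bar>f z - z\<bar> \<ge> Z(u\<^sub>n)\<close> (\<open>displacement_ge_of_large_step\<close>).

  Such a \<open>z\<close> is a one-way barrier: within distance \<open>C(u\<^sub>n)\<close> of \<open>z\<close>, the function \<open>f\<close> moves all points
  in the same direction, and from time \<open>u\<^bsub>n+1\<^esub>\<close> on both \<open>\<bar>x\<^sub>i - x\<^bsub>i+1\<^esub>\<bar>\<close> and \<open>\<bar>x\<^sub>i - y\<^sub>i\<bar>\<close> are at most
  \<open>C(u\<^sub>n)/2\<close>, so \<open>x\<close> cannot jump over \<open>z\<close> in the opposite direction (\<open>one_way_barrier\<close>).
  Hence no cell can be crossed in three windows: the first crossing creates a barrier inside the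
  cell, the second reaches both ends of the cell and so passes the barrier for good, and
  in the third \<open>x\<close> would have to reach both ends again.  As \<open>2m\<^sup>2 + 1 > 2m\<close>, this contradicts the
  pigeonhole principle.
\<close>

section \<open>A pigeonhole principle\<close>

lemma ex_three_ordered_in_fiber:
  fixes h :: "nat \<Rightarrow> 'a"
  assumes "h \<in> A \<rightarrow> K" "finite A" "finite K" "2 * card K < card A"
  obtains n1 n2 n3 where "n1 \<in> A" "n2 \<in> A" "n3 \<in> A" "n1 < n2" "n2 < n3" "h n1 = h n2" "h n2 = h n3"
proof -
  have "\<exists>k\<in>K. 2 < card {n \<in> A. h n = k}"
  proof (rule ccontr)
    assume neg: "\<not> ?thesis"
    have "A = (\<Union>k\<in>K. {n \<in> A. h n = k})" using assms(1) by auto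
    then have "card A \<le> (\<Sum>k\<in>K. card {n \<in> A. h n = k})"
      using card_UN_le[OF assms(3), of "\<lambda>k. {n \<in> A. h n = k}"] by simp
    also have "\<dots> \<le> (\<Sum>k\<in>K. 2)" using neg by (intro sum_mono) (auto simp: not_less)
    finally show False using assms(4) by simp
  qed
  then obtain k where k: "2 < card {n \<in> A. h n = k}" by blast
  define S where "S = {n \<in> A. h n = k}"
  have S: "finite S" "2 < card S" using k assms(2) by (auto simp: S_def)
  then have "S \<noteq> {}" by auto
  have "\<not> S \<subseteq> {Min S, Max S}"
  proof
    assume "S \<subseteq> {Min S, Max S}"
    then have "card S \<le> card {Min S, Max S}" by (intro card_mono) auto
    also have "\<dots> \<le> 2" by (simp add: card_insert_if)
    finally show False using S(2) by simp
  qed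
  then obtain n where n: "n \<in> S" "n \<noteq> Min S" "n \<noteq> Max S" by blast
  then have "Min S < n" "n < Max S" using S(1) by (auto simp: order.strict_iff_order)
  moreover have "Min S \<in> S" "Max S \<in> S" using S(1) \<open>S \<noteq> {}\<close> by auto
  ultimately show thesis using n(1) that[of "Min S" n "Max S"] by (auto simp: S_def)
qed

section \<open>Crossings of an interval\<close>

text \<open>
  The denominator \<open>4h\<close>, in place of \<open>h\<close>, leaves room for the overshoot of at most a quarter
  of \<open>[a,b]\<close> with which the interval may be entered: if all steps from inside were shorter,
  \<open>x\<close> could never get beyond the midpoint.
\<close>

lemma ex_large_step_in_upcrossing:
  fixes x :: "nat \<Rightarrow> real"
  assumes "p \<le> q" "q - p \<le> h" "0 < h" "a < b" "x p \<le> a" "b \<le> x q"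
    and small: "\<And>s. p \<le> s \<Longrightarrow> s < q \<Longrightarrow> \<bar>x s - x (Suc s)\<bar> \<le> (b - a) / 4"
  shows "\<exists>s\<ge>p. s < q \<and> a < x s \<and> x s < b \<and> (b - a) / (4 * real h) \<le> \<bar>x s - x (Suc s)\<bar>"
proof (rule ccontr)
  assume neg: "\<not> ?thesis"
  define \<eta> where "\<eta> = (b - a) / (4 * real h)"
  have \<eta>: "\<eta> > 0" using assms by (simp add: \<eta>_def)
  have quarter: "real d * \<eta> \<le> (b - a) / 4" if "d \<le> h" for d
  proof -
    have "real d * \<eta> \<le> real h * \<eta>" using that \<eta> by (intro mult_right_mono) auto
    also have "\<dots> = (b - a) / 4" using \<open>0 < h\<close> by (simp add: \<eta>_def)
    finally show ?thesis .
  qed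
  have bound: "p + d \<le> q \<longrightarrow> x (p + d) \<le> a + (b - a) / 4 + real d * \<eta>" for d
  proof (induction d)
    case 0
    have "0 < (b - a) / 4" using \<open>a < b\<close> by simp
    then have "x p \<le> a + (b - a) / 4" using \<open>x p \<le> a\<close> by linarith
    then show ?case by simp
  next
    case (Suc d)
    show ?case
    proof
      assume le: "p + Suc d \<le> q"
      have IH: "x (p + d) \<le> a + (b - a) / 4 + real d * \<eta>" using Suc le by simp
      have "real d * \<eta> \<le> (b - a) / 4" using quarter[of d] le assms(2) by simp
      then have "x (p + d) < b" using IH \<open>a < b\<close> by (simp add: field_simps)
      moreover have "\<bar>x (p + d) - x (Suc (p + d))\<bar> \<le> (b - a) / 4" using small[of "p + d"] le by simp
      moreover have "\<bar>x (p + d) - x (Suc (p + d))\<bar> < \<eta>" if "a < x (p + d)" "x (p + d) < b"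
        using neg that le unfolding \<eta>_def[symmetric] by (force simp: not_le)
      moreover have "0 \<le> real d * \<eta>" using \<eta> by simp
      ultimately have "x (Suc (p + d)) \<le> a + (b - a) / 4 + real d * \<eta> + \<eta>"
        using IH \<eta> by linarith
      then show "x (p + Suc d) \<le> a + (b - a) / 4 + real (Suc d) * \<eta>"
        by (simp add: algebra_simps)
    qed
  qed
  have "x q \<le> a + (b - a) / 4 + (b - a) / 4"
    using bound[of "q - p"] quarter[of "q - p"] assms by simp
  then show False using assms by (simp add: field_simps)
qed

lemma ex_large_step_in_crossing:
  fixes x :: "nat \<Rightarrow> real"
  assumes pq: "p \<in> {N..N + h}" "q \<in> {N..N + h}" and "a < b" "x p \<le> a" "b \<le> x q"
    and small: "\<And>s. N \<le> s \<Longrightarrow> \<bar>x s - x (Suc s)\<bar> \<le> (b - a) / 4"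
  shows "\<exists>s\<ge>N. a < x s \<and> x s < b \<and> (b - a) / (4 * real h) \<le> \<bar>x s - x (Suc s)\<bar>"
proof -
  have "p \<noteq> q" using assms by auto
  then have "0 < h" using pq by auto
  show ?thesis
  proof (cases "p \<le> q")
    case True
    then have "\<exists>s\<ge>p. s < q \<and> a < x s \<and> x s < b \<and> (b - a) / (4 * real h) \<le> \<bar>x s - x (Suc s)\<bar>"
      using assms \<open>0 < h\<close> by (intro ex_large_step_in_upcrossing) auto
    then show ?thesis using pq by (auto intro: le_trans)
  next
    case False
    \<comment> \<open>A downcrossing of \<open>[a,b]\<close> by \<open>x\<close> is an upcrossing of \<open>[-b,-a]\<close> by \<open>-x\<close>.\<close>
    then have "\<exists>s\<ge>q. s < p \<and> - b < - x s \<and> - x s < - a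
        \<and> (- a - - b) / (4 * real h) \<le> \<bar>- x s - - x (Suc s)\<bar>"
      using assms \<open>0 < h\<close>
      by (intro ex_large_step_in_upcrossing) (auto simp: abs_minus_commute)
    then show ?thesis using pq by (auto simp: abs_minus_commute intro: le_trans)
  qed
qed

section \<open>Large steps and one-way barriers\<close>

text \<open>
  Here \<open>v\<close>, \<open>w\<close>, \<open>v'\<close> stand for \<open>x\<^sub>n\<close>, \<open>y\<^sub>n\<close>, \<open>x\<^bsub>n+1\<^esub>\<close>.  If \<open>f\<close> moved \<open>v\<close> only a little, then \<open>w\<close> would be close
  to \<open>v\<close>, so \<open>f w\<close> would be close to \<open>f v\<close> and hence to \<open>v\<close>.
\<close>

lemma displacement_ge_of_large_step:
  assumes mod: "modulus_of_uniform_continuity \<omega> f" and "v \<in> {0..1}" "w \<in> {0..1}" "B > 0"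
    and w: "is_between w v (f v)" and v': "is_between v' v (f w)"
    and step: "2 * B \<le> \<bar>v - v'\<bar>"
  shows "min B (\<omega> B) \<le> \<bar>f v - v\<bar>"
proof (rule ccontr)
  assume neg: "\<not> ?thesis"
  then have "\<bar>w - v\<bar> < \<omega> B" using w by (auto simp: is_between_def)
  then have "\<bar>f w - f v\<bar> < B" using assms by (simp add: modulus_of_uniform_continuity_def)
  moreover have "\<bar>v - v'\<bar> \<le> \<bar>f w - v\<bar>" using v' by (auto simp: is_between_def)
  ultimately show False using step neg by auto
qed

text \<open>
  If \<open>f\<close> displaces \<open>z\<close> by at least \<open>\<zeta>\<close>, it displaces every point at distance less than
  \<open>min (\<zeta>/3) (\<omega> (\<zeta>/3))\<close> by at least \<open>\<zeta>/3\<close>, in the same direction.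
\<close>

lemma one_way_barrier:
  assumes mod: "modulus_of_uniform_continuity \<omega> f"
    and x: "\<And>n. x n \<in> {0..1}" and y: "\<And>n. y n \<in> {0..1}"
    and y_between: "\<And>n. is_between (y n) (x n) (f (x n))"
    and x_between: "\<And>n. is_between (x (Suc n)) (x n) (f (y n))"
    and z: "z \<in> {0..1}" "\<zeta> \<le> \<bar>f z - z\<bar>" "\<zeta> > 0"
    and C: "C = min (\<zeta> / 3) (\<omega> (\<zeta> / 3))"
    and x_step: "\<And>n. P \<le> n \<Longrightarrow> \<bar>x n - x (Suc n)\<bar> \<le> C / 2"
    and xy_dist: "\<And>n. P \<le> n \<Longrightarrow> \<bar>x n - y n\<bar> \<le> C / 2"
  shows "(\<forall>i\<ge>P. \<forall>j\<ge>i. z \<le> x i \<longrightarrow> z \<le> x j) \<or> (\<forall>i\<ge>P. \<forall>j\<ge>i. x i \<le> z \<longrightarrow> x j \<le> z)"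
proof -
  have near: "\<bar>f w - f z\<bar> < \<zeta> / 3" "\<bar>w - z\<bar> < \<zeta> / 3" if "w \<in> {0..1}" "\<bar>w - z\<bar> < C" for w
  proof -
    have "0 < \<zeta> / 3" using z(3) by simp
    moreover have "\<bar>w - z\<bar> < \<omega> (\<zeta> / 3)" using that(2) C by simp
    ultimately show "\<bar>f w - f z\<bar> < \<zeta> / 3"
      using mod that(1) z(1) unfolding modulus_of_uniform_continuity_def by metis
    show "\<bar>w - z\<bar> < \<zeta> / 3" using that(2) C by simp
  qed
  consider "z + \<zeta> \<le> f z" | "f z \<le> z - \<zeta>" using z by linarith
  then show ?thesis
  proof cases
    case 1
    have up: "w < f w" if "w \<in> {0..1}" "\<bar>w - z\<bar> < C" for w
      using near[OF that] 1 z by linarith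
    have step: "z \<le> x (Suc n)" if "P \<le> n" "z \<le> x n" for n
    proof (rule ccontr)
      assume neg: "\<not> ?thesis"
      then have dist: "x n - z < C / 2" using x_step[OF that(1)] that by linarith
      then have "x n < f (x n)" using up[OF x] that by auto
      then have "x n \<le> y n" using y_between[of n] by (auto simp: is_between_def)
      moreover from this have "y n < f (y n)"
        using up[OF y, of n] xy_dist[OF that(1)] dist that by auto
      ultimately have "x n \<le> x (Suc n)" using x_between[of n] by (auto simp: is_between_def)
      then show False using neg that by simp
    qed
    have "z \<le> x j" if "P \<le> i" "i \<le> j" "z \<le> x i" for i j
      using that(2) by (induction j rule: dec_induct) (use that step in auto)
    then show ?thesis by blast
  next
    case 2
    have down: "f w < w" if "w \<in> {0..1}" "\<bar>w - z\<bar> < C" for w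
      using near[OF that] 2 z by linarith
    have step: "x (Suc n) \<le> z" if "P \<le> n" "x n \<le> z" for n
    proof (rule ccontr)
      assume neg: "\<not> ?thesis"
      then have dist: "z - x n < C / 2" using x_step[OF that(1)] that by linarith
      then have "f (x n) < x n" using down[OF x] that by auto
      then have "y n \<le> x n" using y_between[of n] by (auto simp: is_between_def)
      moreover from this have "f (y n) < y n"
        using down[OF y, of n] xy_dist[OF that(1)] dist that by auto
      ultimately have "x (Suc n) \<le> x n" using x_between[of n] by (auto simp: is_between_def)
      then show False using neg that by simp
    qed
    have "x j \<le> z" if "P \<le> i" "i \<le> j" "x i \<le> z" for i j
      using that(2) by (induction j rule: dec_induct) (use that step in auto)
    then show ?thesis by blast
  qed
qed

section \<open>The grid and the time scale\<close>

lemma ex_grid_cell_between: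
  fixes s t :: real
  assumes "0 < m" "s \<in> {0..1}" "t \<in> {0..1}" "2 / real m \<le> t - s"
  shows "\<exists>k<m. s \<le> real k / real m \<and> real (Suc k) / real m \<le> t"
proof -
  define k where "k = nat \<lceil>real m * s\<rceil>"
  have "0 \<le> real m * s" using assms by simp
  then have k: "real m * s \<le> real k" "real k < real m * s + 1"
    unfolding k_def by linarith+
  have "2 + real m * s \<le> real m * t" using assms by (simp add: field_simps)
  then have t: "real (Suc k) \<le> real m * t" using k by simp
  also have "\<dots> \<le> real m" using assms by (simp add: mult_left_le)
  finally have "k < m" by simp
  moreover have "s \<le> real k / real m" "real (Suc k) / real m \<le> t"
    using k(1) t assms(1) by (simp_all add: field_simps)
  ultimately show ?thesis by blast
qed

lemma u\<^sub>I_Suc_bounds: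
  fixes \<omega> \<beta> \<gamma> \<epsilon> g
  defines "u \<equiv> u\<^sub>I \<omega> \<beta> \<gamma> \<epsilon> g"
  shows "u n + g (u n) < u (Suc n)"
    and "\<beta> (C\<^sub>I \<omega> \<epsilon> g (u n) / 2) \<le> u (Suc n)"
    and "\<gamma> (C\<^sub>I \<omega> \<epsilon> g (u n) / 2) \<le> u (Suc n)"
  by (simp_all add: u_def Let_def less_eq_Suc_le)

lemma u\<^sub>I_mono: "n \<le> n' \<Longrightarrow> u\<^sub>I \<omega> \<beta> \<gamma> \<epsilon> g n \<le> u\<^sub>I \<omega> \<beta> \<gamma> \<epsilon> g n'"
  by (rule lift_Suc_mono_le[of "u\<^sub>I \<omega> \<beta> \<gamma> \<epsilon> g"])
    (use u\<^sub>I_Suc_bounds(1)[of \<omega> \<beta> \<gamma> \<epsilon> g] in \<open>auto intro: less_imp_le add_lessD1\<close>)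

section \<open>Metastability of the Ishikawa iteration\<close>

lemma tends_with_rateD:
  "tends_with_rate a l \<beta> \<Longrightarrow> 0 < \<delta> \<Longrightarrow> \<beta> \<delta> \<le> n \<Longrightarrow> \<bar>a n - l\<bar> \<le> \<delta>"
  by (simp add: tends_with_rate_def)

theorem theorem3p2:
  fixes f :: "real \<Rightarrow> real" and x y :: "nat \<Rightarrow> real"
    and \<omega> :: "real \<Rightarrow> real" and \<beta> \<gamma> :: "real \<Rightarrow> nat"
    and \<epsilon> :: real and g :: "nat \<Rightarrow> nat"
  assumes "f \<in> {0..1} \<rightarrow> {0..1}"
    and "\<And>n. x n \<in> {0..1}"
    and "\<And>n. y n \<in> {0..1}"
    and "\<And>n. is_between (y n) (x n) (f (x n))"
    and "\<And>n. is_between (x (Suc n)) (x n) (f (y n))"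
    and "modulus_of_uniform_continuity \<omega> f"
    and "tends_with_rate (\<lambda>n. x n - x (Suc n)) 0 \<beta>"
    and "tends_with_rate (\<lambda>n. x n - y n) 0 \<gamma>"
    and "\<epsilon> > 0"
  shows "\<exists>N \<le> \<Phi>\<^sub>I \<omega> \<beta> \<gamma> \<epsilon> g.
           \<forall>i\<in>{N..N + g N}. \<forall>j\<in>{N..N + g N}. \<bar>x i - x j\<bar> \<le> \<epsilon>"
proof (rule ccontr)
  assume neg: "\<not> ?thesis"
  define m where "m = m\<^sub>I \<epsilon>"
  define u where "u = u\<^sub>I \<omega> \<beta> \<gamma> \<epsilon> g"
  have u_mono: "u n \<le> u n'" if "n \<le> n'" for n n'
    using u\<^sub>I_mono[OF that] by (simp add: u_def)
  have m_ge: "6 / \<epsilon> \<le> real m" unfolding m_def m\<^sub>I_def by linarith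
  have "0 < 6 / \<epsilon>" using assms(9) by simp
  then have m: "0 < m" using m_ge by (cases m) auto
  have "6 / real m \<le> \<epsilon>" using m_ge m assms(9) by (simp add: field_simps)
  then have eps: "2 / real m \<le> \<epsilon>" using m by (simp add: field_simps)
  have small: "\<bar>x s - x (Suc s)\<bar> \<le> 1 / (4 * real m)" if "u 0 \<le> s" for s
    using assms(7) that m by (simp add: tends_with_rate_def u_def c\<^sub>I_def m_def)

  have "\<exists>k<m. \<exists>p\<in>{u n..u n + g (u n)}. \<exists>q\<in>{u n..u n + g (u n)}.
      x p \<le> real k / real m \<and> real (Suc k) / real m \<le> x q" if "n \<le> 2 * m\<^sup>2" for n
  proof -
    have "u n \<le> \<Phi>\<^sub>I \<omega> \<beta> \<gamma> \<epsilon> g" using u_mono[OF that] by (simp add: \<Phi>\<^sub>I_def u_def m_def)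
    then obtain i j where ij: "i \<in> {u n..u n + g (u n)}" "j \<in> {u n..u n + g (u n)}" "\<epsilon> < \<bar>x i - x j\<bar>"
      using neg by (meson not_le)
    obtain p q where pq: "p \<in> {u n..u n + g (u n)}" "q \<in> {u n..u n + g (u n)}" "\<epsilon> < x q - x p"
    proof (cases "x i \<le> x j")
      case True
      then show thesis using ij by (intro that[of i j]) auto
    next
      case False
      then show thesis using ij by (intro that[of j i]) auto
    qed
    then have "2 / real m \<le> x q - x p" using eps by simp
    then show ?thesis
      using ex_grid_cell_between[OF m assms(2)[of p] assms(2)[of q]] pq(1,2) by blast
  qed
  then obtain k p q where crossing: "\<And>n. n \<le> 2 * m\<^sup>2 \<Longrightarrow> k n < m
      \<and> p n \<in> {u n..u n + g (u n)} \<and> q n \<in> {u n..u n + g (u n)}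
      \<and> x (p n) \<le> real (k n) / real m \<and> real (Suc (k n)) / real m \<le> x (q n)"
    by metis

  have "m * 1 \<le> m\<^sup>2" unfolding power2_eq_square using m by (intro mult_le_mono2) simp
  then have card: "2 * card {..<m} < card {..2 * m\<^sup>2}" by simp
  have "k \<in> {..2 * m\<^sup>2} \<rightarrow> {..<m}" using crossing by blast
  then obtain n1 n2 n3 where "n1 \<in> {..2 * m\<^sup>2}" "n2 \<in> {..2 * m\<^sup>2}" "n3 \<in> {..2 * m\<^sup>2}"
      and less: "n1 < n2" "n2 < n3" and k_eq: "k n1 = k n2" "k n2 = k n3"
    using ex_three_ordered_in_fiber[OF _ finite_atMost finite_lessThan card] by metis
  then have n: "n1 \<le> 2 * m\<^sup>2" "n2 \<le> 2 * m\<^sup>2" "n3 \<le> 2 * m\<^sup>2" by simp_all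
  define a where "a = real (k n1) / real m"
  define b where "b = real (Suc (k n1)) / real m"
  have ab: "b - a = 1 / real m" by (simp add: a_def b_def diff_divide_distrib[symmetric])
  have ends: "x (p n) \<le> a" "b \<le> x (q n)" if "n \<in> {n1, n2, n3}" for n
    using that crossing[OF n(1)] crossing[OF n(2)] crossing[OF n(3)] k_eq
    by (auto simp: a_def b_def)

  define B where "B = B\<^sub>I \<epsilon> g (u n1)"
  define Z where "Z = Z\<^sub>I \<omega> \<epsilon> g (u n1)"
  define C where "C = C\<^sub>I \<omega> \<epsilon> g (u n1)"
  have \<omega>_pos: "0 < \<omega> \<delta>" if "0 < \<delta>" for \<delta>
    using assms(6) that by (auto simp: modulus_of_uniform_continuity_def)
  have "0 < B" by (simp add: B_def B\<^sub>I_def)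
  then have "0 < Z" using \<omega>_pos by (simp add: Z_def Z\<^sub>I_def B_def)
  then have "0 < C" using \<omega>_pos by (simp add: C_def C\<^sub>I_def Z_def)

  have "0 < b - a" using m by (simp add: ab)
  then have "a < b" by simp
  have "\<exists>s\<ge>u n1. a < x s \<and> x s < b \<and> (b - a) / (4 * real (g (u n1))) \<le> \<bar>x s - x (Suc s)\<bar>"
  proof (rule ex_large_step_in_crossing)
    show "\<bar>x s - x (Suc s)\<bar> \<le> (b - a) / 4" if "u n1 \<le> s" for s
      using small[of s] u_mono[of 0 n1] that by (simp add: ab mult.commute)
  qed (use crossing[OF n(1)] ends[of n1] \<open>a < b\<close> in auto)
  then obtain s where s: "a < x s" "x s < b"
      and large: "(b - a) / (4 * real (g (u n1))) \<le> \<bar>x s - x (Suc s)\<bar>"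
    by blast
  have "p n1 \<noteq> q n1" using ends[of n1] \<open>a < b\<close> by auto
  then have "1 \<le> g (u n1)" using crossing[OF n(1)] by auto
  then have "1 \<le> 8 * (m * g (u n1))" using m by simp
  then have "real 1 \<le> real (8 * (m * g (u n1)))" by (rule of_nat_mono)
  then have "1 \<le> 8 * real m * real (g (u n1))" by simp
  \<comment> \<open>The maximum in the definition of \<open>B\<close> is therefore attained by its second argument.\<close>
  then have "2 * B = (b - a) / (4 * real (g (u n1)))"
    by (simp add: B_def B\<^sub>I_def m_def max_def ab)
  then have "min B (\<omega> B) \<le> \<bar>f (x s) - x s\<bar>"
    using displacement_ge_of_large_step[OF assms(6,2,3) \<open>0 < B\<close> assms(4,5)] large by simp
  then have "Z \<le> \<bar>f (x s) - x s\<bar>" by (simp add: Z_def Z\<^sub>I_def B_def)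

  then have barrier: "(\<forall>i\<ge>u (Suc n1). \<forall>j\<ge>i. x s \<le> x i \<longrightarrow> x s \<le> x j)
      \<or> (\<forall>i\<ge>u (Suc n1). \<forall>j\<ge>i. x i \<le> x s \<longrightarrow> x j \<le> x s)"
  proof (rule one_way_barrier[where f = f and x = x and y = y and z = "x s" and \<zeta> = Z and C = C,
        OF assms(6,2,3,4,5,2) _ \<open>0 < Z\<close>])
    show "C = min (Z / 3) (\<omega> (Z / 3))" by (simp add: C_def C\<^sub>I_def Z_def)
    show "\<bar>x n - x (Suc n)\<bar> \<le> C / 2" if "u (Suc n1) \<le> n" for n
    proof -
      have "\<beta> (C / 2) \<le> u (Suc n1)" unfolding u_def C_def by (rule u\<^sub>I_Suc_bounds)
      then show ?thesis
        using tends_with_rateD[OF assms(7), of "C / 2" n] \<open>0 < C\<close> that by simp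
    qed
    show "\<bar>x n - y n\<bar> \<le> C / 2" if "u (Suc n1) \<le> n" for n
    proof -
      have "\<gamma> (C / 2) \<le> u (Suc n1)" unfolding u_def C_def by (rule u\<^sub>I_Suc_bounds)
      then show ?thesis
        using tends_with_rateD[OF assms(8), of "C / 2" n] \<open>0 < C\<close> that by simp
    qed
  qed

  have "u (Suc n1) \<le> u n2" using less by (intro u_mono) simp
  then have after: "u (Suc n1) \<le> p n2" "u (Suc n1) \<le> q n2" using crossing[OF n(2)] by auto
  have "u n2 + g (u n2) < u (Suc n2)" unfolding u_def by (rule u\<^sub>I_Suc_bounds)
  also have "\<dots> \<le> u n3" using less by (intro u_mono) simp
  finally have order: "q n2 \<le> p n3" "p n2 \<le> q n3"
    using crossing[OF n(2)] crossing[OF n(3)] by auto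
  from barrier show False
  proof
    assume "\<forall>i\<ge>u (Suc n1). \<forall>j\<ge>i. x s \<le> x i \<longrightarrow> x s \<le> x j"
    then have "x s \<le> x (p n3)" using after order ends(2)[of n2] s by auto
    then show False using ends(1)[of n3] s by simp
  next
    assume "\<forall>i\<ge>u (Suc n1). \<forall>j\<ge>i. x i \<le> x s \<longrightarrow> x j \<le> x s"
    then have "x (q n3) \<le> x s" using after order ends(1)[of n2] s by auto
    then show False using ends(2)[of n3] s by simp
  qed
qed

end
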